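(* Let $N,M$ be positive integers, let $\mathcal A,\mathcal M\in\mathbb C^{N\times N}$ with $\mathcal A$ Hermitian positive semi-definite and $\mathcal M$ Hermitian positive definite, let $\mathcal B\in\mathbb C^{N\times M}$ satisfy $\mathcal A\mathcal M^{-1}\mathcal B=0$, let $\mathcal U\in\mathbb C^{M\times M}$ be Hermitian positive definite, let $c\ge 0$ be real, and let $\mathcal F\in\mathbb C^N$. Suppose $\dim\mathbb C_0=0$. Then the constrained system $$(\mathcal A+c\mathcal M)u+\mathcal B p=\mathcal F,\qquad \mathcal B^* u=0\qquad (u\in\mathbb C^N,\ p\in\mathbb C^M)$$ has a solution $(u,p)$ whose component $u$ is unique, and this $u$ is obtained as follows: there is a unique $\tilde u\in\mathbb C^N$ with $$(\mathcal A+\mathcal B\mathcal U\mathcal B^* )\tilde u=\mathcal F,$$ and then $u$ is the unique solution in $\mathbb C^N$ of $$(\mathcal A+\mathcal B\mathcal U\mathcal B^*+c\mathcal M)u=\mathcal F-\mathcal B\mathcal U\mathcal B^*\tilde u.$$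
   Context: $X^*$ denotes the conjugate transpose of a matrix $X$. $\mathbb C_0:=\operatorname{Ker}\mathcal A\cap\operatorname{Ker}(\mathcal B\mathcal U\mathcal B^* )\subset\mathbb C^N$. *)

theory Defs
  imports "HOL-Analysis.Analysis"
begin

definition conj_transpose :: "complex ^ 'n ^ 'm \<Rightarrow> complex ^ 'm ^ 'n" where
  "conj_transpose X = (\<chi> i j. cnj (X $ j $ i))"

definition hermitian :: "complex ^ 'n ^ 'n \<Rightarrow> bool" where
  "hermitian X \<longleftrightarrow> conj_transpose X = X"

definition quad_form :: "complex ^ 'n ^ 'n \<Rightarrow> complex ^ 'n \<Rightarrow> complex" where
  "quad_form X v = (\<Sum>i\<in>UNIV. cnj (v $ i) * (X *v v) $ i)"

(* For Hermitian X the quadratic form is real-valued, so passing to the real part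
   loses nothing. *)

definition hermitian_psd :: "complex ^ 'n ^ 'n \<Rightarrow> bool" where
  "hermitian_psd X \<longleftrightarrow> hermitian X \<and> (\<forall>v. 0 \<le> Re (quad_form X v))"

definition hermitian_pd :: "complex ^ 'n ^ 'n \<Rightarrow> bool" where
  "hermitian_pd X \<longleftrightarrow> hermitian X \<and> (\<forall>v. v \<noteq> 0 \<longrightarrow> 0 < Re (quad_form X v))"

definition mat_ker :: "complex ^ 'n ^ 'm \<Rightarrow> (complex ^ 'n) set" where
  "mat_ker X = {v. X *v v = 0}"

definition C0 :: "complex ^ 'n ^ 'n \<Rightarrow> complex ^ 'm ^ 'n \<Rightarrow> complex ^ 'm ^ 'm \<Rightarrow> (complex ^ 'n) set" where
  "C0 A B U = mat_ker A \<inter> mat_ker (B ** U ** conj_transpose B)"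

definition constrained_system ::
  "complex ^ 'n ^ 'n \<Rightarrow> complex ^ 'n ^ 'n \<Rightarrow> complex ^ 'm ^ 'n \<Rightarrow> real \<Rightarrow> complex ^ 'n
    \<Rightarrow> complex ^ 'n \<Rightarrow> complex ^ 'm \<Rightarrow> bool" where
  "constrained_system A M B c F u p \<longleftrightarrow>
     (A + c *\<^sub>R M) *v u + B *v p = F \<and> conj_transpose B *v u = 0"

end

(*
  Idea: write K = B U B^*.  For a positive semi-definite X, v^* X v = 0 forces X v = 0, so the
  kernel of A + K is C0 = 0.  To see B^* u = 0, put w = B^* u and z = M^{-1} B U w.  Then A z = 0,
  and pairing (A + K + c M) u = A ut with z leaves z^* M z + c w^* U w = 0.  Hence B U w = M z = 0
  and w^* U w = u^* B U w = 0, even when c = 0.  The multiplier is p = U B^* ut.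
*)
theory Submission
  imports Defs
begin

text \<open>The Hermitian inner product, conjugate-linear in the first argument to match
  \<open>quad_form\<close>. Its values stay complex; real parts are taken only where signs
  matter.\<close>

definition cdot :: "complex ^ 'n \<Rightarrow> complex ^ 'n \<Rightarrow> complex" where
  "cdot x y = (\<Sum>i\<in>UNIV. cnj (x $ i) * y $ i)"

lemma quad_form_eq_cdot: "quad_form X v = cdot v (X *v v)"
  by (simp add: quad_form_def cdot_def)

lemma cdot_zero [simp]: "cdot 0 y = 0" "cdot x 0 = 0"
  by (simp_all add: cdot_def)

lemma cdot_add_left: "cdot (x + y) z = cdot x z + cdot y z"
  by (simp add: cdot_def algebra_simps sum.distrib)

lemma cdot_add_right: "cdot x (y + z) = cdot x y + cdot x z"
  by (simp add: cdot_def algebra_simps sum.distrib)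

lemma cdot_scaleR_left: "cdot (r *\<^sub>R x) y = r *\<^sub>R cdot x y"
  by (simp add: cdot_def scaleR_sum_right)

lemma cdot_scaleR_right: "cdot x (r *\<^sub>R y) = r *\<^sub>R cdot x y"
  by (simp add: cdot_def scaleR_sum_right)

lemma cdot_self_eq_0_iff: "Re (cdot x x) = 0 \<longleftrightarrow> x = 0"
proof -
  have "Re (cdot x x) = (\<Sum>i\<in>UNIV. (cmod (x $ i))\<^sup>2)"
    by (simp add: cdot_def cmod_power2 flip: power2_eq_square)
  then show ?thesis
    by (simp add: sum_nonneg_eq_0_iff vec_eq_iff)
qed

lemma cdot_self_nonneg: "0 \<le> Re (cdot x x)"
  by (simp add: cdot_def sum_nonneg)

lemma cdot_matrix_vector: "cdot x (X *v y) = cdot (conj_transpose X *v x) y"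
proof -
  have "cdot x (X *v y) = (\<Sum>i\<in>UNIV. \<Sum>j\<in>UNIV. cnj (x $ i) * (X $ i $ j * y $ j))"
    by (simp add: cdot_def matrix_vector_mult_def sum_distrib_left)
  also have "\<dots> = (\<Sum>j\<in>UNIV. \<Sum>i\<in>UNIV. cnj (x $ i) * (X $ i $ j * y $ j))"
    by (rule sum.swap)
  also have "\<dots> = cdot (conj_transpose X *v x) y"
    by (simp add: cdot_def matrix_vector_mult_def conj_transpose_def sum_distrib_left mult_ac)
  finally show ?thesis .
qed

lemma conj_transpose_conj_transpose [simp]: "conj_transpose (conj_transpose X) = X"
  by (simp add: conj_transpose_def vec_eq_iff)

lemma cdot_hermitian: "hermitian X \<Longrightarrow> cdot x (X *v y) = cdot (X *v x) y"
  by (simp add: cdot_matrix_vector hermitian_def)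

lemma matrix_vector_scaleR_left: "(r *\<^sub>R X) *v (v :: complex ^ 'n) = r *\<^sub>R (X *v v)"
  by (simp add: matrix_vector_mult_def vec_eq_iff scaleR_sum_right)

lemma matrix_vector_scaleR_right: "X *v (r *\<^sub>R v) = r *\<^sub>R (X *v (v :: complex ^ 'n))"
  by (simp add: matrix_vector_mult_def vec_eq_iff scaleR_sum_right)

text \<open>Moving \<open>B\<close> to the other side of \<open>cdot\<close> as its adjoint
  transfers positivity from \<open>U\<close> to B U B^*.\<close>

lemma quad_form_congruence:
  "quad_form (B ** U ** conj_transpose B) v = quad_form U (conj_transpose B *v v)"
  by (simp add: quad_form_eq_cdot cdot_matrix_vector [of _ B] flip: matrix_vector_mul_assoc)

lemma hermitian_pd_imp_psd: "hermitian_pd X \<Longrightarrow> hermitian_psd X"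
  unfolding hermitian_pd_def hermitian_psd_def
  by (metis cdot_zero(1) less_eq_real_def quad_form_eq_cdot zero_complex.simps(1))

lemma hermitian_pd_quad_form_eq_0: "hermitian_pd X \<Longrightarrow> Re (quad_form X v) = 0 \<Longrightarrow> v = 0"
  unfolding hermitian_pd_def by force

text \<open>If y = X v were nonzero, moving from \<open>v\<close> a suitable distance along -y would
  make the quadratic form negative: it vanishes at \<open>v\<close> and its slope along
  \<open>y\<close> is twice the squared norm of \<open>y\<close>.\<close>

lemma hermitian_psd_quad_form_eq_0:
  assumes X: "hermitian_psd X" and v: "Re (quad_form X v) = 0"
  shows "X *v v = 0"
proof (rule ccontr)
  assume "X *v v \<noteq> 0"
  define y where "y = X *v v"
  define n where "n = Re (cdot y y)"
  define q where "q = Re (quad_form X y)"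
  have "n > 0"
    using \<open>X *v v \<noteq> 0\<close> cdot_self_nonneg [of y] cdot_self_eq_0_iff [of y]
    by (simp add: n_def y_def)
  have herm: "hermitian X"
    using X by (simp add: hermitian_psd_def)
  have *: "0 \<le> 2 * t * n + t\<^sup>2 * q" for t :: real
  proof -
    have "quad_form X (v + t *\<^sub>R y)
        = quad_form X v + t *\<^sub>R cdot v (X *v y) + t *\<^sub>R cdot y y + t *\<^sub>R t *\<^sub>R quad_form X y"
      by (simp add: quad_form_eq_cdot matrix_vector_right_distrib matrix_vector_scaleR_right
          cdot_add_left cdot_add_right cdot_scaleR_left cdot_scaleR_right scaleR_add_right
          flip: y_def)
    moreover have "cdot v (X *v y) = cdot y y"
      using cdot_hermitian [OF herm, of v y] by (simp add: y_def)
    ultimately have "Re (quad_form X (v + t *\<^sub>R y)) = 2 * t * n + t\<^sup>2 * q"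
      using v by (simp add: n_def q_def power2_eq_square)
    then show ?thesis
      using X unfolding hermitian_psd_def by (metis (no_types))
  qed
  \<comment> \<open>Taking t = -1 gives 2 n \<le> q, so division by \<open>q\<close> is
    safe.\<close>
  have "q > 0"
    using * [of "-1"] \<open>n > 0\<close> by simp
  \<comment> \<open>The value t = -n/q minimises the quadratic in \<open>*\<close>.\<close>
  then have "2 * (- n / q) * n + (- n / q)\<^sup>2 * q = - n\<^sup>2 / q"
    by (simp add: field_simps power2_eq_square)
  also have "\<dots> < 0"
    using \<open>n > 0\<close> \<open>q > 0\<close> by simp
  finally show False
    using * [of "- n / q"] by linarith
qed

text \<open>A trivial kernel gives a left inverse \<open>T\<close>, which for a square matrix is
  also a right inverse; \<open>T *v F\<close> is then the solution.\<close>

lemma square_matrix_ex1: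
  fixes S :: "'a::field ^ 'n ^ 'n"
  assumes "\<And>v. S *v v = 0 \<Longrightarrow> v = 0"
  shows "\<exists>!v. S *v v = F"
proof -
  have "\<exists>T. T ** S = mat 1"
    unfolding matrix_left_invertible_ker using assms by (intro allI impI)
  then obtain T where T: "T ** S = mat 1" ..
  then have T': "S ** T = mat 1"
    by (rule matrix_left_right_inverse [THEN iffD1])
  show ?thesis
  proof (rule ex1I)
    show "S *v (T *v F) = F"
      by (simp only: matrix_vector_mul_assoc T' matrix_vector_mul_lid)
    show "v = T *v F" if "S *v v = F" for v
      by (simp only: that [symmetric] matrix_vector_mul_assoc T matrix_vector_mul_lid)
  qed
qed

text \<open>\<open>matrix_inv\<close> is a choice among two-sided inverses, so one must be exhibited
  before its property can be used; definiteness supplies it through the trivial kernel.\<close>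

lemma hermitian_pd_inv_mult:
  assumes "hermitian_pd X"
  shows "X *v (matrix_inv X *v v) = v"
proof -
  have ker: "v = 0" if "X *v v = 0" for v
    using that hermitian_pd_quad_form_eq_0 [OF assms, of v] by (simp add: quad_form_eq_cdot)
  then have "\<exists>T. T ** X = mat 1"
    unfolding matrix_left_invertible_ker by (intro allI impI)
  then obtain T where T: "T ** X = mat 1" ..
  then have "X ** T = mat 1"
    by (rule matrix_left_right_inverse [THEN iffD1])
  then have "X ** T = mat 1 \<and> T ** X = mat 1"
    using T by (rule conjI)
  then have "X ** matrix_inv X = mat 1"
    unfolding matrix_inv_def by (rule someI2) simp
  then show ?thesis
    by (simp add: matrix_vector_mul_assoc)
qed

theorem mainTheorem1:
  fixes A M :: "complex ^ 'n ^ 'n"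
    and B :: "complex ^ 'm ^ 'n"
    and U :: "complex ^ 'm ^ 'm"
    and c :: real
    and F :: "complex ^ 'n"
  assumes "hermitian_psd A"
    and "hermitian_pd M"
    and "A ** matrix_inv M ** B = 0"
    and "hermitian_pd U"
    and "0 \<le> c"
    and "vec.dim (C0 A B U) = 0"
  shows "\<exists>u ut.
      (\<exists>p. constrained_system A M B c F u p) \<and>
      (\<forall>u' p'. constrained_system A M B c F u' p' \<longrightarrow> u' = u) \<and>
      (A + B ** U ** conj_transpose B) *v ut = F \<and>
      (\<forall>ut'. (A + B ** U ** conj_transpose B) *v ut' = F \<longrightarrow> ut' = ut) \<and>
      (A + B ** U ** conj_transpose B + c *\<^sub>R M) *v u
        = F - (B ** U ** conj_transpose B) *v ut \<and>
      (\<forall>u'. (A + B ** U ** conj_transpose B + c *\<^sub>R M) *v u'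
        = F - (B ** U ** conj_transpose B) *v ut \<longrightarrow> u' = u)"
proof -
  define K where "K = B ** U ** conj_transpose B"
  have K: "K *v v = B *v (U *v (conj_transpose B *v v))" for v
    by (simp add: K_def flip: matrix_vector_mul_assoc)
  have hA: "hermitian A" and hM: "hermitian M" and hU: "hermitian U"
    using assms(1,2,4) by (simp_all add: hermitian_psd_def hermitian_pd_def)
  have qA: "0 \<le> Re (quad_form A v)" for v
    using assms(1) by (simp add: hermitian_psd_def)
  have qM: "0 \<le> Re (quad_form M v)" for v
    using hermitian_pd_imp_psd [OF assms(2)] by (simp add: hermitian_psd_def)
  have qU: "0 \<le> Re (quad_form U v)" for v
    using hermitian_pd_imp_psd [OF assms(4)] by (simp add: hermitian_psd_def)
  have qcM: "0 \<le> c * Re (quad_form M v)" for v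
    using qM assms(5) by simp
  have qK: "quad_form K v = quad_form U (conj_transpose B *v v)" for v
    by (simp add: K_def quad_form_congruence)
  have C0: "v = 0" if "A *v v = 0" "conj_transpose B *v v = 0" for v
  proof -
    have "v \<in> C0 A B U"
      using that K [of v] by (simp add: C0_def mat_ker_def flip: K_def)
    moreover have "C0 A B U \<subseteq> {0}"
      using assms(6) vec.dim_eq_0 by blast
    ultimately show ?thesis
      by blast
  qed
  \<comment> \<open>Semi-definiteness of \<open>A\<close> yields A v = 0, and definiteness of
    \<open>U\<close> yields B^* v = 0.\<close>
  have zero: "v = 0" if "Re (quad_form A v) = 0" "Re (quad_form K v) = 0" for v
    using that C0 hermitian_psd_quad_form_eq_0 [OF assms(1)] hermitian_pd_quad_form_eq_0 [OF assms(4)]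
    by (simp add: qK)
  \<comment> \<open>Stated for general \<open>r\<close> to serve both linear systems: r = 0 gives
    \<open>ut\<close> and r = c gives \<open>u\<close>. In the kernel, three nonnegative terms sum
    to zero, so the first two vanish.\<close>
  have ex1: "\<exists>!v. (A + K + r *\<^sub>R M) *v v = G" if "0 \<le> r" for r G
  proof (rule square_matrix_ex1)
    fix v
    assume "(A + K + r *\<^sub>R M) *v v = 0"
    then have "Re (cdot v ((A + K + r *\<^sub>R M) *v v)) = 0"
      by simp
    then have "Re (quad_form A v) + Re (quad_form K v) + r * Re (quad_form M v) = 0"
      by (simp add: matrix_vector_mult_add_rdistrib matrix_vector_scaleR_left cdot_add_right
          cdot_scaleR_right quad_form_eq_cdot)
    moreover have "0 \<le> r * Re (quad_form M v)"
      using qM that by simp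
    ultimately show "v = 0"
      using zero qA [of v] qU [of "conj_transpose B *v v"] by (simp add: qK)
  qed
  obtain ut where ut: "(A + K) *v ut = F" and ut_unique: "\<And>v. (A + K) *v v = F \<Longrightarrow> v = ut"
    using ex1 [of 0 F] unfolding scaleR_zero_left add_0_right by blast
  obtain u where u: "(A + K + c *\<^sub>R M) *v u = F - K *v ut"
    and u_unique: "\<And>v. (A + K + c *\<^sub>R M) *v v = F - K *v ut \<Longrightarrow> v = u"
    using ex1 [OF assms(5), of "F - K *v ut"] by blast
  \<comment> \<open>Writing \<open>F\<close> as (A + K) ut cancels K ut and leaves a right-hand side
    in the range of \<open>A\<close>, which is orthogonal to any \<open>z\<close> with A z =
    0.\<close>
  have eq: "A *v u + K *v u + c *\<^sub>R (M *v u) = A *v ut"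
    using u by (simp add: matrix_vector_mult_add_rdistrib matrix_vector_scaleR_left flip: ut)
  define w where "w = conj_transpose B *v u"
  define z where "z = matrix_inv M *v (B *v (U *v w))"
  have Mz: "M *v z = B *v (U *v w)"
    by (simp add: z_def hermitian_pd_inv_mult [OF assms(2)])
  have "A *v z = (A ** matrix_inv M ** B) *v (U *v w)"
    by (simp add: z_def flip: matrix_vector_mul_assoc)
  then have Az: "A *v z = 0"
    using assms(3) by simp
  have zA: "cdot z (A *v v) = 0" for v
    by (simp add: cdot_hermitian [OF hA] Az)
  have zK: "cdot z (K *v u) = quad_form M z"
    by (simp add: K quad_form_eq_cdot Mz flip: w_def)
  \<comment> \<open>Since \<open>M\<close> is Hermitian it acts on \<open>z\<close> instead, giving
    B U w; then \<open>B\<close> passes to \<open>u\<close> as B^* u = w.\<close>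
  have zM: "cdot z (M *v u) = quad_form U w"
  proof -
    have "cdot z (M *v u) = cdot (B *v (U *v w)) u"
      by (simp add: cdot_hermitian [OF hM] Mz)
    also have "\<dots> = cdot (U *v w) w"
      using cdot_matrix_vector [of "U *v w" "conj_transpose B" u] by (simp add: w_def)
    finally show ?thesis
      by (simp add: quad_form_eq_cdot cdot_hermitian [OF hU])
  qed
  have "quad_form M z + c *\<^sub>R quad_form U w = 0"
    using arg_cong [OF eq, of "cdot z"] by (simp add: cdot_add_right cdot_scaleR_right zA zK zM)
  then have "Re (quad_form M z) + c * Re (quad_form U w) = 0"
    by (metis plus_complex.simps(1) scaleR_complex.simps(1) zero_complex.simps(1))
  moreover have "0 \<le> c * Re (quad_form U w)"
    using qU assms(5) by simp
  ultimately have "Re (quad_form M z) = 0"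
    using qM [of z] by linarith
  then have "z = 0"
    by (rule hermitian_pd_quad_form_eq_0 [OF assms(2)])
  then have Ku: "K *v u = 0"
    using Mz by (simp add: K flip: w_def)
  \<comment> \<open>For c = 0 the paired identity says nothing about \<open>w\<close>, so
    \<open>w\<close> is reached through u^* K u = w^* U w.\<close>
  then have "quad_form U w = 0"
    using qK [of u] by (simp add: quad_form_eq_cdot w_def)
  then have w: "w = 0"
    using hermitian_pd_quad_form_eq_0 [OF assms(4)] by simp
  \<comment> \<open>With K u = 0, \<open>eq\<close> reads (A + c M) u = A ut = F - K ut, and K ut is
    \<open>B\<close> applied to the chosen multiplier.\<close>
  have sol: "constrained_system A M B c F u (U *v (conj_transpose B *v ut))"
    using eq ut w Ku
    by (simp add: constrained_system_def matrix_vector_mult_add_rdistrib matrix_vector_scaleR_left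
        w_def flip: K)
  have sol_unique: "u' = u" if "constrained_system A M B c F u' p'" for u' p'
  proof -
    define p where "p = U *v (conj_transpose B *v ut)"
    define d where "d = u' - u"
    have Bd: "conj_transpose B *v d = 0"
      using that sol by (simp add: d_def constrained_system_def matrix_vector_mult_diff_distrib)
    have "(A + c *\<^sub>R M) *v d + B *v (p' - p) = 0"
      using that sol
      by (simp add: d_def constrained_system_def matrix_vector_mult_diff_distrib
          algebra_simps flip: p_def)
    \<comment> \<open>As B^* d = 0, pairing with \<open>d\<close> removes the multipliers, which may
      differ between solutions.\<close>
    then have "cdot d ((A + c *\<^sub>R M) *v d + B *v (p' - p)) = 0"
      by simp
    then have "quad_form A d + c *\<^sub>R quad_form M d = 0"
      by (simp add: matrix_vector_mult_add_rdistrib matrix_vector_scaleR_left cdot_add_right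
          cdot_scaleR_right cdot_matrix_vector [of d B] Bd quad_form_eq_cdot)
    then have "Re (quad_form A d) + c * Re (quad_form M d) = 0"
      by (metis plus_complex.simps(1) scaleR_complex.simps(1) zero_complex.simps(1))
    then have "Re (quad_form A d) = 0"
      using qA [of d] qcM [of d] by linarith
    \<comment> \<open>The vanishing form gives A d = 0; with B^* d = 0 this puts \<open>d\<close> in
      the trivial space \<open>C0 A B U\<close>, whether or not c = 0.\<close>
    then have "d = 0"
      using C0 Bd hermitian_psd_quad_form_eq_0 [OF assms(1)] by blast
    then show ?thesis
      by (simp add: d_def)
  qed
  show ?thesis
    unfolding K_def [symmetric]
  proof (intro exI conjI allI impI)
    show "constrained_system A M B c F u (U *v (conj_transpose B *v ut))"
      by (rule sol)
  qed (fact sol_unique ut ut_unique u u_unique)+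
qed

end
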